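(* Let $n$ be a positive integer, $p$ a prime not dividing $n$, and $m\ge2$. Then $$P_{p^mn}(s,t)=\begin{cases}P_{p^{m-1}n}(s^2+2t,\,-t^2) & \text{if } p=2,\\ P_{p^{m-1}n}\big(s\,P_{2p}(s,t),\,t^p\big) & \text{if } p\ge3.\end{cases}$$
   Context: Let $\Phi_n(q)$ be the $n$th cyclotomic polynomial and $\phi$ the Euler totient function. For $n\ge 2$, $\Phi_n(q)$ is palindromic of degree $\phi(n)$ with constant term $1$, so there are unique complex numbers $\gamma_j$ with $\Phi_n(q)=\sum_{0\le j\le \phi(n)/2}\gamma_j q^j(1+q)^{\phi(n)-2j}$; the $n$th Lucas atom is $P_n(s,t)=\sum_j \gamma_j s^{\phi(n)-2j}(-t)^j$ for $n\ge 2$, and $P_1(s,t)=1$. $P_n(a,b)$ denotes $P_n$ with $s,t$ replaced by $a,b$. *)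

theory Defs
  imports
    "HOL-Number_Theory.Totient"
    "HOL-Computational_Algebra.Polynomial"
    Complex_Main
begin

definition cyclotomic_poly :: "nat \<Rightarrow> complex poly" where
  "cyclotomic_poly n = (\<Prod>k\<in>totatives n. [:- cis (2 * pi * real k / real n), 1:])"

text \<open>
  The coefficients of the expansion of \<open>cyclotomic_poly n\<close> in the polynomials
  \<open>q^j (1+q)^(totient n - 2j)\<close>, extended by zero to all \<open>j\<close> so that the description is unique
  as a function on the naturals. The range \<open>j \<le> totient n div 2\<close> makes the natural number
  subtraction exact.  Existence and uniqueness for \<open>n \<ge> 2\<close> are shown below.
\<close>

definition is_gamma_expansion :: "nat \<Rightarrow> (nat \<Rightarrow> complex) \<Rightarrow> bool" where
  "is_gamma_expansion n g \<longleftrightarrow>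
     (\<forall>j. j > totient n div 2 \<longrightarrow> g j = 0) \<and>
     cyclotomic_poly n =
       (\<Sum>j\<le>totient n div 2. smult (g j) ([:0, 1:] ^ j * [:1, 1:] ^ (totient n - 2 * j)))"

definition gamma_coeff :: "nat \<Rightarrow> nat \<Rightarrow> complex" where
  "gamma_coeff n = (THE g. is_gamma_expansion n g)"

text \<open>
  \<open>complex poly poly\<close> serves as the polynomial ring in the two indeterminates \<open>s\<close> (inner) and
  \<open>t\<close> (outer); \<open>subst_st P a b\<close> replaces \<open>s\<close> by \<open>a\<close> and \<open>t\<close> by \<open>b\<close> in \<open>P\<close>.
\<close>

definition var_s :: "complex poly poly" where
  "var_s = [:[:0, 1:]:]"

definition var_t :: "complex poly poly" where
  "var_t = [:0, 1:]"

definition subst_st ::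
  "complex poly poly \<Rightarrow> complex poly poly \<Rightarrow> complex poly poly \<Rightarrow> complex poly poly" where
  "subst_st P a b = poly (map_poly (\<lambda>c. poly (map_poly (\<lambda>z. [:[:z:]:]) c) a) P) b"

text \<open>The value at \<open>n = 0\<close> is irrelevant.\<close>

definition lucas_atom :: "nat \<Rightarrow> complex poly poly" where
  "lucas_atom n =
     (if n = 1 then 1
      else (\<Sum>j\<le>totient n div 2.
              [:[:gamma_coeff n j:]:] * var_s ^ (totient n - 2 * j) * (- var_t) ^ j))"


lemma subst_st_vars: "subst_st var_s a b = a" "subst_st var_t a b = b"
  by (simp_all add: subst_st_def var_s_def var_t_def map_poly_pCons pCons_one map_poly_1')

lemma degree_cyclotomic_poly: "degree (cyclotomic_poly n) = totient n"
  unfolding cyclotomic_poly_def totient_def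
  by (subst degree_prod_eq_sum_degree) auto

lemma poly_cyclotomic_poly_1_nonzero:
  assumes "n \<ge> 2"
  shows "poly (cyclotomic_poly n) 1 \<noteq> 0"
proof -
  have "cis (2 * pi * real k / real n) \<noteq> 1" if "k \<in> totatives n" for k
  proof
    assume *: "cis (2 * pi * real k / real n) = 1"
    have "k \<noteq> n" "0 < k" "k \<le> n" using that assms by (auto simp: in_totatives_iff)
    hence k: "0 < k" "k < n" by auto
    have "inj_on (\<lambda>k. cis (2 * pi * real k / real n)) {..<n}"
      using bij_betw_roots_unity[of n] assms by (auto simp: bij_betw_def)
    from inj_onD[OF this, of k 0] * k show False by auto
  qed
  thus ?thesis by (auto simp: cyclotomic_poly_def poly_prod)
qed

lemma reflect_cyclotomic_poly:
  assumes "n \<ge> 2"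
  shows "reflect_poly (cyclotomic_poly n) = cyclotomic_poly n"
proof -
  define w where "w = (\<lambda>k. cis (2 * pi * real k / real n))"
  have w_refl: "reflect_poly [:- w k, 1:] = smult (- w k) [:- w (n - k), 1:]"
    if "k \<in> totatives n" for k
  proof -
    have kn: "k \<le> n" using that by (simp add: in_totatives_iff)
    have "w k * w (n - k) = cis (2 * pi)"
      using kn assms by (simp add: w_def cis_mult of_nat_diff field_simps)
    hence "w k * w (n - k) = 1" by simp
    thus ?thesis by (simp add: reflect_poly_pCons w_def)
  qed
  have bij: "bij_betw (\<lambda>k. n - k) (totatives n) (totatives n)"
  proof (rule bij_betw_byWitness[where f' = "\<lambda>k. n - k"])
    have *: "n - k \<in> totatives n" if "k \<in> totatives n" for k
    proof -
      have "k \<noteq> n" using that assms by (auto simp: in_totatives_iff)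
      moreover have "coprime (n - k) n"
        using that gcd_diff2_nat[of k n]
        by (simp add: in_totatives_iff coprime_iff_gcd_eq_1)
      ultimately show ?thesis using that by (auto simp: in_totatives_iff)
    qed
    thus "(\<lambda>k. n - k) ` totatives n \<subseteq> totatives n" "(\<lambda>k. n - k) ` totatives n \<subseteq> totatives n"
      by auto
  qed (auto simp: in_totatives_iff)
  define c where "c = (\<Prod>k\<in>totatives n. - w k)"
  have "reflect_poly (cyclotomic_poly n)
      = (\<Prod>k\<in>totatives n. smult (- w k) [:- w (n - k), 1:])"
    unfolding cyclotomic_poly_def reflect_poly_prod
    by (intro prod.cong refl) (use w_refl in \<open>simp add: w_def\<close>)
  also have "\<dots> = smult c (\<Prod>k\<in>totatives n. [:- w (n - k), 1:])"
    unfolding c_def by (rule prod_smult)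
  also have "(\<Prod>k\<in>totatives n. [:- w (n - k), 1:]) = cyclotomic_poly n"
    unfolding cyclotomic_poly_def w_def[symmetric]
    using prod.reindex_bij_betw[OF bij, of "\<lambda>k. [:- w k, 1:]"] by (simp add: w_def)
  finally have eq: "reflect_poly (cyclotomic_poly n) = smult c (cyclotomic_poly n)" .
  have "poly (reflect_poly (cyclotomic_poly n)) 1 = poly (cyclotomic_poly n) 1"
    by (simp add: poly_reflect_poly_nz)
  with eq poly_cyclotomic_poly_1_nonzero[OF assms] have "c = 1" by simp
  with eq show ?thesis by simp
qed

lemma gamma_expansion_exists:
  fixes P :: "'a :: idom poly"
  assumes "\<And>i. i > d \<Longrightarrow> coeff P i = 0" "\<And>i. i \<le> d \<Longrightarrow> coeff P i = coeff P (d - i)"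
  shows "\<exists>g. P = (\<Sum>j\<le>d div 2. smult (g j) ([:0, 1:] ^ j * [:1, 1:] ^ (d - 2 * j)))"
  using assms
proof (induction d arbitrary: P rule: less_induct)
  case (less d)
  define c where "c = coeff P 0"
  define Q where "Q = P - smult c ([:1, 1:] ^ d)"
  have bin: "coeff ([:1, 1:] ^ d :: 'a poly) i = of_nat (d choose i)" for i
    using coeff_linear_poly_power[of i d "1 :: 'a" 1] 
    by (cases "i \<le> d") (auto simp: coeff_eq_0 degree_linear_power binomial_eq_0)
  have Q: "coeff Q i = coeff P i - c * of_nat (d choose i)" for i
    by (simp add: Q_def bin)
  have Q_van: "coeff Q i = 0" if "i > d" for i
    using that less.prems(1) by (simp add: Q binomial_eq_0)
  have Q_pal: "coeff Q i = coeff Q (d - i)" if "i \<le> d" for i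
    using that less.prems(2)[OF that] binomial_symmetric[OF that] by (simp add: Q)
  have Q0: "coeff Q 0 = 0" by (simp add: Q c_def)
  have Qd: "coeff Q d = 0" using Q_pal[of d] Q0 by simp
  show ?case
  proof (cases "d < 2")
    case True
    have "coeff Q i = 0" for i
      using Q0 Qd Q_van[of i] True by (cases "i > d"; cases "i = 0"; cases "i = d") auto
    hence "Q = 0" by (simp add: poly_eq_iff)
    hence "P = smult c ([:1, 1:] ^ d)" by (simp add: Q_def)
    with True show ?thesis by (intro exI[of _ "\<lambda>_. c"]) auto
  next
    case False
    obtain R where R: "Q = pCons 0 R" using Q0 by (cases Q) auto
    have "\<exists>g. R = (\<Sum>j\<le>(d - 2) div 2. smult (g j) ([:0, 1:] ^ j * [:1, 1:] ^ (d - 2 - 2 * j)))"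
    proof (rule less.IH)
      show "d - 2 < d" using False by simp
      show "coeff R i = 0" if "i > d - 2" for i
        using that Q_van[of "Suc i"] Qd False unfolding R
        by (cases "Suc i = d") auto
      show "coeff R i = coeff R (d - 2 - i)" if "i \<le> d - 2" for i
      proof -
        have "d - Suc i = Suc (d - 2 - i)" using that False by simp
        thus ?thesis using that False Q_pal[of "Suc i"] unfolding R by simp
      qed
    qed
    then obtain g where
      g: "R = (\<Sum>j\<le>(d - 2) div 2. smult (g j) ([:0, 1:] ^ j * [:1, 1:] ^ (d - 2 - 2 * j)))" ..
    define h where "h j = (if j = 0 then c else g (j - 1))" for j
    have "(\<Sum>j\<le>d div 2. smult (h j) ([:0, 1:] ^ j * [:1, 1:] ^ (d - 2 * j)))
        = (\<Sum>j\<le>Suc ((d - 2) div 2). smult (h j) ([:0, 1:] ^ j * [:1, 1:] ^ (d - 2 * j)))"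
      using False by (intro sum.cong) auto
    also have "\<dots> = smult c ([:1, 1:] ^ d) + [:0, 1:] * R"
      unfolding g sum.atMost_Suc_shift
      by (simp only: h_def sum_distrib_left) (simp add: mult.assoc mult_smult_right)
    also have "\<dots> = smult c ([:1, 1:] ^ d) + Q" by (simp add: R)
    also have "\<dots> = P" by (simp add: Q_def)
    finally show ?thesis by (intro exI[of _ h]) simp
  qed
qed

lemma gamma_expansion_zero:
  fixes g :: "nat \<Rightarrow> 'a :: idom"
  assumes "(\<Sum>j\<le>m. smult (g j) ([:0, 1:] ^ j * [:1, 1:] ^ e j)) = 0" "j \<le> m"
  shows "g j = 0"
  using assms(2)
proof (induction j rule: less_induct)
  case (less j)
  have c: "coeff ([:0, 1:] ^ i * r) j = (if i \<le> j then coeff r (j - i) else 0)"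
    for i and r :: "'a poly"
    using coeff_monom_mult[of 1 i r j] by (simp add: monom_altdef)
  have "0 = coeff (\<Sum>i\<le>m. smult (g i) ([:0, 1:] ^ i * [:1, 1:] ^ e i)) j"
    by (simp add: assms(1))
  also have "\<dots> = (\<Sum>i\<le>m. if i = j then g j else 0)"
    unfolding coeff_sum
  proof (intro sum.cong refl)
    fix i assume "i \<in> {..m}"
    show "coeff (smult (g i) ([:0, 1:] ^ i * [:1, 1:] ^ e i)) j = (if i = j then g j else 0)"
      using less.IH[of i] less.prems
      by (cases i j rule: linorder_cases) (auto simp: c coeff_0_power)
  qed
  also have "\<dots> = g j" using less.prems by simp
  finally show ?case by simp
qed

lemma gamma_expansion_ex1:
  assumes "n \<ge> 2"
  shows "\<exists>!g. is_gamma_expansion n g"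
proof -
  let ?d = "totient n"
  let ?b = "\<lambda>j. [:0, 1:] ^ j * [:1, 1:] ^ (?d - 2 * j) :: complex poly"
  have "coeff (cyclotomic_poly n) i = coeff (cyclotomic_poly n) (?d - i)" if "i \<le> ?d" for i
    using that reflect_cyclotomic_poly[OF assms] coeff_reflect_poly[of "cyclotomic_poly n" i]
    by (simp add: degree_cyclotomic_poly)
  moreover have "coeff (cyclotomic_poly n) i = 0" if "i > ?d" for i
    using that by (simp add: coeff_eq_0 degree_cyclotomic_poly)
  ultimately obtain g where g: "cyclotomic_poly n = (\<Sum>j\<le>?d div 2. smult (g j) (?b j))"
    using gamma_expansion_exists[of ?d "cyclotomic_poly n"] by blast
  show ?thesis
  proof (rule ex1I)
    show "is_gamma_expansion n (\<lambda>j. if j \<le> ?d div 2 then g j else 0)"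
      unfolding is_gamma_expansion_def using g by (auto intro!: sum.cong)
    fix h assume h: "is_gamma_expansion n h"
    have "(\<Sum>j\<le>?d div 2. smult (h j - g j) (?b j)) = 0"
      using h g by (simp add: is_gamma_expansion_def smult_diff_left sum_subtractf)
    hence "h j - g j = 0" if "j \<le> ?d div 2" for j
      using gamma_expansion_zero[of "\<lambda>j. h j - g j" "\<lambda>j. ?d - 2 * j" "?d div 2" j] that by simp
    thus "h = (\<lambda>j. if j \<le> ?d div 2 then g j else 0)"
      using h by (auto simp: is_gamma_expansion_def fun_eq_iff)
  qed
qed

end

theory Submission
  imports Defs
begin

text \<open>
  Substituting \<open>s = x + y\<close>, \<open>t = - x y\<close> turns the Lucas atom into the homogenised cyclotomic
  polynomial \<open>y ^ totient n * \<Phi>\<^sub>n (x / y)\<close>, and every pair \<open>(s, t)\<close> with \<open>t \<noteq> 0\<close> arises in this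
  way with \<open>y \<noteq> 0\<close>. Under this substitution \<open>s\<^sup>2 + 2 t\<close> becomes \<open>x\<^sup>2 + y\<^sup>2\<close>, and
  \<open>s P\<^bsub>2p\<^esub>(s, t)\<close> becomes \<open>x ^ p + y ^ p\<close> for odd \<open>p\<close>, so both cases express
  \<open>\<Phi>\<^bsub>pN\<^esub>(q) = \<Phi>\<^sub>N(q ^ p)\<close> for \<open>p dvd N\<close>.
\<close>

text \<open>Both sides have the same coefficient at \<open>card A\<close>, so their difference has
  smaller degree, yet it vanishes at the \<open>card A\<close> distinct points \<open>f k\<close>.
  This identifies products over roots of unity by checking roots alone.\<close>

lemma prod_linear_eq_monic_poly:
  fixes Q :: "'a :: idom poly"
  assumes "finite A" "inj_on f A" "\<And>k. k \<in> A \<Longrightarrow> poly Q (f k) = 0"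
    and "lead_coeff Q = 1" "degree Q = card A"
  shows "(\<Prod>k\<in>A. [:- f k, 1:]) = Q"
proof (rule poly_eqI_degree_lead_coeff[where A = "f ` A" and n = "card A"])
  have deg: "degree (\<Prod>k\<in>A. [:- f k, 1:]) = card A"
    by (subst degree_prod_eq_sum_degree) auto
  then show "degree (\<Prod>k\<in>A. [:- f k, 1:]) \<le> card A" "degree Q \<le> card A"
    using assms by auto
  have "lead_coeff (\<Prod>k\<in>A. [:- f k, 1:]) = 1"
    by (simp add: lead_coeff_prod)
  then show "coeff (\<Prod>k\<in>A. [:- f k, 1:]) (card A) = coeff Q (card A)"
    using assms deg by simp
  show "card (f ` A) \<ge> card A" using assms by (simp add: card_image)
  fix z assume "z \<in> f ` A"
  then show "poly (\<Prod>k\<in>A. [:- f k, 1:]) z = poly Q z"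
    using assms by (auto simp: poly_prod)
qed

lemma inj_on_root_of_unity:
  assumes "n > 0"
  shows "inj_on (\<lambda>k. cis (2 * pi * real k / real n)) {..<n}"
  using bij_betw_roots_unity[OF assms] by (auto simp: bij_betw_def)

lemma totatives_subset_lessThan:
  assumes "n \<ge> 2"
  shows "totatives n \<subseteq> {..<n}"
proof
  fix k assume "k \<in> totatives n"
  with assms have "k \<noteq> n" "k \<le> n" by (auto simp: in_totatives_iff)
  then show "k \<in> {..<n}" by simp
qed

lemma cis_mod_period:
  assumes "n > 0"
  shows "cis (2 * pi * real (k mod n) / real n) = cis (2 * pi * real k / real n)"
proof -
  have "real k = real n * real (k div n) + real (k mod n)"
    by (metis mult_div_mod_eq of_nat_add of_nat_mult)
  then have "2 * pi * real k / real n
      = 2 * pi * real (k div n) + 2 * pi * real (k mod n) / real n"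
    using assms by (simp add: field_simps)
  moreover have "cis (2 * pi * real (k div n)) = 1"
    by (rule cis_multiple_2pi) simp
  ultimately show ?thesis by (simp add: cis_mult [symmetric])
qed

lemma cyclotomic_poly_root:
  assumes "n \<ge> 2" "coprime k n"
  shows "poly (cyclotomic_poly n) (cis (2 * pi * real k / real n)) = 0"
proof -
  \<comment> \<open>Reducing modulo \<open>n\<close> brings an arbitrary exponent into
    \<open>totatives n\<close>, which excludes 0; here \<open>n \<ge> 2\<close> rules out
    \<open>n dvd k\<close>.\<close>
  have "k mod n \<noteq> 0" using assms by (auto simp: mod_eq_0_iff_dvd)
  moreover have "coprime (k mod n) n" using assms by simp
  ultimately have "k mod n \<in> totatives n" 
    using assms by (auto simp: in_totatives_iff intro!: less_imp_le)
  moreover have "cis (2 * pi * real (k mod n) / real n) = cis (2 * pi * real k / real n)"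
    using assms by (intro cis_mod_period) simp
  ultimately show ?thesis
    unfolding cyclotomic_poly_def poly_prod by (intro prod_zero) (auto intro!: bexI[of _ "k mod n"])
qed

lemma lead_coeff_cyclotomic_poly: "lead_coeff (cyclotomic_poly n) = 1"
  unfolding cyclotomic_poly_def by (simp add: lead_coeff_prod)

lemma totient_prime_times_multiple:
  assumes "prime p" "p dvd N"
  shows "totient (p * N) = p * totient N"
  using totient_mult[of p N] assms by simp

text \<open>The \<open>p\<close>-th power of a primitive \<open>p * N\<close>-th root of unity is a
  primitive \<open>N\<close>-th one, and the degrees agree because \<open>p dvd N\<close>.\<close>

lemma cyclotomic_poly_prime_times_multiple:
  assumes "prime p" "p dvd N" "N > 0"
  shows "poly (cyclotomic_poly (p * N)) q = poly (cyclotomic_poly N) (q ^ p)"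
proof -
  have p: "p \<ge> 2" using assms prime_ge_2_nat by blast
  have N: "N \<ge> 2" using assms p dvd_imp_le order_trans by blast
  have pN: "p * N \<ge> 2" using p N by (simp add: order_trans[OF p])
  define Q where "Q = pcompose (cyclotomic_poly N) (monom 1 p)"
  have Q: "poly Q z = poly (cyclotomic_poly N) (z ^ p)" for z
    by (simp add: Q_def poly_pcompose poly_monom)
  have "cyclotomic_poly (p * N) = Q"
    unfolding cyclotomic_poly_def
  proof (rule prod_linear_eq_monic_poly)
    show "inj_on (\<lambda>k. cis (2 * pi * real k / real (p * N))) (totatives (p * N))"
      by (rule inj_on_subset[OF inj_on_root_of_unity totatives_subset_lessThan])
         (use p N pN in auto)
    show "lead_coeff Q = 1"
      using p by (simp add: Q_def lead_coeff_comp degree_monom_eq lead_coeff_cyclotomic_poly)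
    show "degree Q = card (totatives (p * N))"
      using totient_prime_times_multiple[OF assms(1,2)]
      by (simp add: Q_def degree_pcompose degree_monom_eq degree_cyclotomic_poly
        flip: totient_def)
    fix k assume "k \<in> totatives (p * N)"
    then have "coprime k N" by (simp add: in_totatives_iff)
    moreover have "cis (2 * pi * real k / real (p * N)) ^ p = cis (2 * pi * real k / real N)"
      using p N by (simp add: Complex.DeMoivre field_simps)
    ultimately show "poly Q (cis (2 * pi * real k / real (p * N))) = 0"
      using cyclotomic_poly_root[OF N] by (simp add: Q)
  qed simp
  then show ?thesis by (simp add: Q)
qed

text \<open>The roots of \<open>q ^ p + 1\<close> are the \<open>2p\<close>-th roots of unity with
  odd exponent: the primitive ones, and -1 at exponent \<open>p\<close>, which accounts for the
  factor \<open>1 + q\<close>.\<close>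

lemma cyclotomic_poly_twice_odd_prime:
  assumes "prime p" "odd p"
  shows "(1 + q) * poly (cyclotomic_poly (2 * p)) q = 1 + q ^ p"
proof -
  have p: "p \<ge> 2" using assms prime_ge_2_nat by blast
  define f where "f k = cis (2 * pi * real k / real (2 * p))" for k
  define Q :: "complex poly" where "Q = monom 1 p + 1"
  have deg: "degree Q = p"
    using p unfolding Q_def by (subst degree_add_eq_left) (auto simp: degree_monom_eq)
  have "p \<notin> totatives (2 * p)" using p by (simp add: in_totatives_iff)
  have "(\<Prod>k\<in>insert p (totatives (2 * p)). [:- f k, 1:]) = Q"
  proof (rule prod_linear_eq_monic_poly)
    show "inj_on f (insert p (totatives (2 * p)))"
      unfolding f_def using p totatives_subset_lessThan[of "2 * p"]
      by (intro inj_on_subset[OF inj_on_root_of_unity]) auto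
    show "lead_coeff Q = 1" using p by (simp add: deg) (simp add: Q_def)
    have "totient (2 * p) = p - 1"
      using assms by (simp add: totient_double totient_prime)
    then show "degree Q = card (insert p (totatives (2 * p)))"
      using p \<open>p \<notin> _\<close> by (simp add: deg totient_def)
    fix k assume "k \<in> insert p (totatives (2 * p))"
    then have "odd k" using assms by (auto simp: in_totatives_iff)
    have "f k ^ p = cis (pi * real k)"
      using p by (simp add: f_def Complex.DeMoivre field_simps)
    also have "\<dots> = -1" using \<open>odd k\<close> 
      by (metis Complex.DeMoivre cis_pi mult.commute power_minus_odd power_one)
    finally show "poly Q (f k) = 0" by (simp add: Q_def poly_monom)
  qed simp
  moreover have "f p = -1" using p by (simp add: f_def)
  ultimately have "[:1, 1:] * cyclotomic_poly (2 * p) = Q"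
    using \<open>p \<notin> _\<close> by (simp add: cyclotomic_poly_def f_def add_ac)
  then have "poly ([:1, 1:] * cyclotomic_poly (2 * p)) q = poly Q q" by simp
  then show ?thesis by (simp add: Q_def poly_monom algebra_simps)
qed

text \<open>The outer indeterminate is \<open>t\<close>, so it is evaluated first, at a constant
  polynomial in \<open>s\<close>.\<close>

definition eval_st :: "complex \<Rightarrow> complex \<Rightarrow> complex poly poly \<Rightarrow> complex" where
  "eval_st s t P = poly (poly P [:t:]) s"

lemma eval_st_simps [simp]:
  "eval_st s t (P + Q) = eval_st s t P + eval_st s t Q"
  "eval_st s t (P * Q) = eval_st s t P * eval_st s t Q"
  "eval_st s t (- P) = - eval_st s t P"
  "eval_st s t (P ^ k) = eval_st s t P ^ k"
  "eval_st s t 0 = 0" "eval_st s t 1 = 1" "eval_st s t (numeral w) = numeral w"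
  "eval_st s t [:[:z:]:] = z" "eval_st s t (smult [:z:] P) = z * eval_st s t P"
  "eval_st s t var_s = s" "eval_st s t var_t = t"
  by (simp_all add: eval_st_def var_s_def var_t_def)

lemma eval_st_sum [simp]: "eval_st s t (sum f A) = (\<Sum>k\<in>A. eval_st s t (f k))"
  by (simp add: eval_st_def poly_sum)

lemma eval_st_subst_st:
  "eval_st s t (subst_st P a b) = eval_st (eval_st s t a) (eval_st s t b) P"
proof -
  have inner: "eval_st s t (poly (map_poly (\<lambda>z. [:[:z:]:]) c) a) = poly c (eval_st s t a)" for c
    by (induction c) (simp_all add: map_poly_pCons)
  show ?thesis unfolding subst_st_def
  proof (induction P)
    case 0
    show ?case by simp
  next
    case (pCons c P)
    then show ?case by (simp add: map_poly_pCons inner) (simp add: eval_st_def)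
  qed
qed

text \<open>As a polynomial in \<open>t\<close> over the domain \<open>complex poly\<close>, a
  nonzero \<open>P - Q\<close> has finitely many roots, whereas every constant \<open>[:t:]\<close>
  with \<open>t \<noteq> 0\<close> would be one. Leaving out \<open>t = 0\<close> is what permits
  division by \<open>y\<close> later.\<close>

lemma eval_st_eqI:
  assumes "\<And>s t. t \<noteq> 0 \<Longrightarrow> eval_st s t P = eval_st s t Q"
  shows "P = Q"
proof (rule ccontr)
  assume "P \<noteq> Q"
  then have "finite {c. poly (P - Q) c = 0}" by (intro poly_roots_finite) simp
  moreover have "(\<lambda>t. [:t:]) ` (- {0}) \<subseteq> {c. poly (P - Q) c = 0}"
    using assms by (auto simp: eval_st_def poly_eq_poly_eq_iff[symmetric] fun_eq_iff)
  ultimately have "finite ((\<lambda>t :: complex. [:t:]) ` (- {0}))" by (rule rev_finite_subset)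
  then have "finite (- {0 :: complex})" by (rule finite_imageD) (simp add: inj_on_def)
  then show False by (simp add: infinite_UNIV_char_0)
qed

text \<open>Take \<open>x\<close> and \<open>y\<close> to be the roots of
  \<open>z^2 - s z - t\<close>; \<open>r\<close> is a square root of its discriminant.\<close>

lemma exists_sum_product:
  fixes s t :: complex
  shows "\<exists>x y. s = x + y \<and> t = - (x * y)"
proof (intro exI conjI)
  define r where "r = csqrt (s\<^sup>2 + 4 * t)"
  have "r\<^sup>2 = s\<^sup>2 + 4 * t" by (simp add: r_def)
  then show "t = - ((s + r) / 2 * ((s - r) / 2))"
    by (simp add: field_simps power2_eq_square)
  show "s = (s + r) / 2 + (s - r) / 2" by (simp add: field_simps)
qed

text \<open>Here \<open>-t = x * y\<close>, so the atom is the gamma expansion at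
  \<open>q = x / y\<close> with denominators cleared by \<open>y ^ totient n\<close>.\<close>

lemma eval_st_lucas_atom:
  assumes "n \<ge> 2" "y \<noteq> 0"
  shows "eval_st (x + y) (- (x * y)) (lucas_atom n)
    = y ^ totient n * poly (cyclotomic_poly n) (x / y)"
proof -
  have "is_gamma_expansion n (gamma_coeff n)"
    unfolding gamma_coeff_def by (rule theI'[OF gamma_expansion_ex1[OF assms(1)]])
  then have "poly (cyclotomic_poly n) (x / y)
    = (\<Sum>j\<le>totient n div 2. gamma_coeff n j * ((x / y) ^ j * (1 + x / y) ^ (totient n - 2 * j)))"
    by (simp add: is_gamma_expansion_def poly_sum)
  moreover have "gamma_coeff n j * ((x + y) ^ (totient n - 2 * j) * (x * y) ^ j)
      = y ^ totient n * (gamma_coeff n j * ((x / y) ^ j * (1 + x / y) ^ (totient n - 2 * j)))"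
    if "j \<le> totient n div 2" for j
  proof -
    \<comment> \<open>The bound on \<open>j\<close> makes the truncated subtraction exact; the three
      powers of \<open>y\<close> are absorbed by \<open>1 + x / y\<close> and, in pairs, by
      \<open>x / y\<close>.\<close>
    have "totient n = (totient n - 2 * j) + j + j" using that by simp
    then have "y ^ totient n = y ^ (totient n - 2 * j) * y ^ j * y ^ j"
      by (metis power_add)
    moreover have "x + y = y * (1 + x / y)" "x * y = y * y * (x / y)"
      using assms by (simp_all add: field_simps)
    ultimately show ?thesis by (simp only: power_mult_distrib mult_ac)
  qed
  ultimately show ?thesis
    using assms(1) by (auto simp: lucas_atom_def sum_distrib_left intro!: sum.cong)
qed

theorem theorem5p11:
  fixes n p m :: nat
  assumes "n > 0" and "prime p" and "\<not> p dvd n" and "m \<ge> 2"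
  shows "lucas_atom (p ^ m * n) =
    (if p = 2
     then subst_st (lucas_atom (p ^ (m - 1) * n)) (var_s ^ 2 + 2 * var_t) (- (var_t ^ 2))
     else subst_st (lucas_atom (p ^ (m - 1) * n)) (var_s * lucas_atom (2 * p)) (var_t ^ p))"
    (is "?L = ?R")
proof (rule eval_st_eqI)
  fix s t :: complex assume "t \<noteq> 0"
  obtain x y where xy: "s = x + y" "t = - (x * y)" using exists_sum_product by blast
  with \<open>t \<noteq> 0\<close> have y: "y \<noteq> 0" by auto
  define N where "N = p ^ (m - 1) * n"
  have pN: "p ^ m * n = p * N" using assms by (cases m) (simp_all add: N_def)
  \<comment> \<open>Since \<open>m \<ge> 2\<close>, at least one factor \<open>p\<close> remains in
    \<open>N\<close>.\<close>
  have dvd: "p dvd N" using assms by (simp add: N_def)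
  have "N > 0" using assms by (simp add: N_def prime_gt_0_nat)
  have p2: "p \<ge> 2" using assms prime_ge_2_nat by blast
  have N2: "N \<ge> 2" using p2 dvd \<open>N > 0\<close> dvd_imp_le order_trans by blast
  have pN2: "p * N \<ge> 2" using p2 \<open>N > 0\<close> by (cases N) auto
  have "eval_st s t ?L = y ^ (p * totient N) * poly (cyclotomic_poly N) ((x / y) ^ p)"
    using eval_st_lucas_atom[OF pN2 y, of x] totient_prime_times_multiple[OF assms(2) dvd]
      cyclotomic_poly_prime_times_multiple[OF assms(2) dvd \<open>N > 0\<close>]
    by (simp add: pN xy)
  \<comment> \<open>The homogenisation formula is read backwards, with \<open>x ^ p\<close> and
    \<open>y ^ p\<close> in the roles of \<open>x\<close> and \<open>y\<close>.\<close>
  also have "\<dots> = eval_st (x ^ p + y ^ p) (- (x ^ p * y ^ p)) (lucas_atom N)"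
    using y by (subst eval_st_lucas_atom[OF N2]) (simp_all add: power_mult power_divide)
  also have "\<dots> = eval_st s t ?R"
  proof (cases "p = 2")
    case True
    have "s\<^sup>2 + 2 * t = x\<^sup>2 + y\<^sup>2" "- (t\<^sup>2) = - (x\<^sup>2 * y\<^sup>2)"
      unfolding xy by (simp_all add: power2_eq_square algebra_simps)
    then show ?thesis using True by (simp add: eval_st_subst_st N_def)
  next
    case False
    then have "odd p" using assms p2 prime_odd_nat by fastforce
    have "eval_st s t (lucas_atom (2 * p)) = y ^ (p - 1) * poly (cyclotomic_poly (2 * p)) (x / y)"
      unfolding xy using y p2 assms \<open>odd p\<close>
      by (subst eval_st_lucas_atom) (simp_all add: totient_double totient_prime)
    \<comment> \<open>Writing \<open>s = y * (1 + x / y)\<close> supplies both the missing power of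
      \<open>y\<close> and the missing factor of \<open>1 + q ^ p\<close> at
      \<open>q = x / y\<close>.\<close>
    then have "s * eval_st s t (lucas_atom (2 * p))
        = (y * y ^ (p - 1)) * ((1 + x / y) * poly (cyclotomic_poly (2 * p)) (x / y))"
      using y by (simp add: xy field_simps)
    also have "\<dots> = y ^ p * (1 + (x / y) ^ p)"
      using cyclotomic_poly_twice_odd_prime[OF assms(2) \<open>odd p\<close>] p2
      by (simp add: power_eq_if)
    also have "\<dots> = x ^ p + y ^ p"
      using y by (simp add: field_simps power_divide)
    finally have "s * eval_st s t (lucas_atom (2 * p)) = x ^ p + y ^ p" .
    \<comment> \<open>Oddness of \<open>p\<close> preserves the sign of
      \<open>t = - (x * y)\<close>; for \<open>p = 2\<close> the explicit minus in
      \<open>- (var_t ^ 2)\<close> restores it.\<close>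
    moreover have "t ^ p = - (x ^ p * y ^ p)"
      using \<open>odd p\<close> by (simp add: xy power_mult_distrib)
    ultimately show ?thesis using False by (simp add: eval_st_subst_st N_def)
  qed
  finally show "eval_st s t ?L = eval_st s t ?R" .
qed

end
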